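(* Let $n \geq 2$ be an integer, let $K$ be a field with at least $n$ elements, let $m \in \{1,2,3\}$, and let $f \in K\langle x_1, \dots, x_m\rangle$ be any nonzero multilinear polynomial of degree $m$. Then $f(\mathbb{M}_n(K))$ contains every matrix in $\mathbb{M}_n(K)$ having trace $0$.
   Context: For a field $K$ and a positive integer $m$, $K\langle x_1,\dots,x_m\rangle$ denotes the free associative unital $K$-algebra on the non-commuting variables $x_1,\dots,x_m$. A polynomial $f \in K\langle x_1,\dots,x_m\rangle$ is called multilinear (of degree $m$) if it is of the form $f(x_1,\dots,x_m)=\sum_{\sigma\in S_m} a_\sigma x_{\sigma(1)}x_{\sigma(2)}\cdots x_{\sigma(m)}$ with $a_\sigma\in K$, where $S_m$ is the group of all permutations of $\{1,\dots,m\}$. $\mathbb{M}_n(K)$ is the algebra of $n\times n$ matrices over $K$, and for a $K$-algebra $A$, $f(A)=\{f(r_1,\dots,r_m)\mid r_1,\dots,r_m\in A\}$ is the set of values of $f$ on $A$. *)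

theory Defs
  imports
    "Jordan_Normal_Form.Matrix"
    "HOL-Library.Poly_Mapping"
    "HOL-Combinatorics.Permutations"
begin

(* The free monoid on the letters x_0, x_1, ..., written additively because
   Poly_Mapping builds monoid algebras over additive monoids. *)

datatype nc_word = NC_Word (letters: "nat list")

instantiation nc_word :: monoid_add
begin

definition zero_nc_word :: nc_word
  where "0 = NC_Word []"

definition plus_nc_word :: "nc_word \<Rightarrow> nc_word \<Rightarrow> nc_word"
  where "v + w = NC_Word (letters v @ letters w)"

instance
  by standard (simp_all add: zero_nc_word_def plus_nc_word_def)

end

(* With the convolution product of Poly_Mapping this is the free associative unital
   algebra over 'k on the variables indexed by nat; nc_polys m is its subalgebra
   on x_1, ..., x_m. *)

type_synonym 'k nc_poly = "nc_word \<Rightarrow>\<^sub>0 'k"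

definition nc_const :: "'k::zero \<Rightarrow> 'k nc_poly"
  where "nc_const c = Poly_Mapping.single 0 c"

definition nc_var :: "nat \<Rightarrow> 'k::zero_neq_one nc_poly"
  where "nc_var i = Poly_Mapping.single (NC_Word [i]) 1"

definition nc_polys :: "nat \<Rightarrow> 'k::zero nc_poly set"
  where "nc_polys m = {f. \<forall>w \<in> Poly_Mapping.keys f. set (letters w) \<subseteq> {1..m}}"

definition multilinear :: "nat \<Rightarrow> 'k::field nc_poly \<Rightarrow> bool"
  where "multilinear m f \<longleftrightarrow> (\<exists>a :: (nat \<Rightarrow> nat) \<Rightarrow> 'k.
    f = (\<Sum>\<sigma> | \<sigma> permutes {1..m}. nc_const (a \<sigma>) * (\<Prod>i\<leftarrow>[1..<Suc m]. nc_var (\<sigma> i))))"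

(* The record type ('k, 'a) module also carries the ring operations of 'a, so it serves
   here for (not necessarily commutative) algebras over the field 'k. *)

definition nc_word_eval :: "('k, 'a) module \<Rightarrow> (nat \<Rightarrow> 'a) \<Rightarrow> nc_word \<Rightarrow> 'a"
  where "nc_word_eval A r w = foldr (\<lambda>i p. r i \<otimes>\<^bsub>A\<^esub> p) (letters w) \<one>\<^bsub>A\<^esub>"

definition nc_eval :: "('k::zero, 'a) module \<Rightarrow> (nat \<Rightarrow> 'a) \<Rightarrow> 'k nc_poly \<Rightarrow> 'a"
  where "nc_eval A r f =
    (\<Oplus>\<^bsub>A\<^esub>w \<in> Poly_Mapping.keys f. Poly_Mapping.lookup f w \<odot>\<^bsub>A\<^esub> nc_word_eval A r w)"

definition nc_values :: "('k::zero, 'a) module \<Rightarrow> nat \<Rightarrow> 'k nc_poly \<Rightarrow> 'a set"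
  where "nc_values A m f = {nc_eval A r f | r. \<forall>i \<in> {1..m}. r i \<in> carrier A}"

definition mat_trace :: "'k::comm_monoid_add mat \<Rightarrow> 'k"
  where "mat_trace M = (\<Sum>i<dim_row M. M $$ (i, i))"

end

theory Submission
  imports Defs "Jordan_Normal_Form.Column_Operations"
begin

text \<open>
  Putting the identity matrix for one variable of a multilinear polynomial of degree three leaves a
  polynomial \<open>a x y + b y x\<close> whose coefficients are sums of three of the original ones. If \<open>a + b \<noteq> 0\<close>, substituting the identity once more leaves a nonzero
  multiple of a single variable, which takes every value; if \<open>b = - a \<noteq> 0\<close>, a commutator is left.
  When all three substitutions into a polynomial of degree three give zero, solving the resulting linear
  equations shows that the polynomial is the Lie polynomial \<open>c [x, [y, z]] + d [y, [x, z]]\<close>. Everything therefore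
  rests on the claim that this Lie polynomial, with \<open>c\<close> or \<open>d\<close> nonzero, takes every trace-zero
  matrix \<open>T\<close> as a value (lemma \<open>double_bracket_trace_zero\<close>); the case \<open>c = 1\<close>, \<open>d = 0\<close> also shows
  that \<open>T\<close> is a commutator. Exchanging \<open>x\<close> and \<open>y\<close> exchanges \<open>c\<close> and \<open>d\<close>, so \<open>c \<noteq> 0\<close> may be assumed.

  If \<open>T\<close> is not scalar, it is similar to a matrix with zero diagonal (\<open>similar_zero_diagonal\<close>),
  and the set of values is closed under conjugation. For a diagonal matrix \<open>D\<close> with \<open>n\<close> distinct
  entries, the substitution \<open>x = z = D\<close> kills the second term, and \<open>y \<mapsto> [D, [y, D]]\<close> multiplies the
  entry in position \<open>(i, j)\<close> by \<open>-(d\<^sub>i - d\<^sub>j)\<^sup>2\<close>, so it maps onto the matrices with zero diagonal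
  (\<open>double_bracket_zero_diagonal\<close>). Here the size of the field enters.

  A nonzero scalar matrix of trace zero exists only if the characteristic divides \<open>n\<close>. In that case
  differentiation \<open>\<partial>\<close> and multiplication by \<open>t\<close> act on \<open>K[t]/(t\<^sup>n)\<close> with \<open>[\<partial>, t] = 1\<close>. With the
  Euler operator \<open>E = t \<partial>\<close>, for which \<open>[E, t] = t\<close>, one gets \<open>[\<partial>, [E, t]] = 1\<close> and
  \<open>[E, [\<partial>, t]] = 0\<close>, in every characteristic, including 2 (\<open>double_bracket_scalar\<close>).
\<close>

section \<open>Values of multilinear polynomials\<close>

lemma prod_list_nc_var:
  "(\<Prod>i\<leftarrow>xs. nc_var (\<sigma> i)) = (Poly_Mapping.single (NC_Word (map \<sigma> xs)) 1 :: 'k::field nc_poly)"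
proof (induction xs)
  case Nil
  then show ?case by (simp flip: zero_nc_word_def)
next
  case (Cons a xs)
  then show ?case by (simp add: nc_var_def mult_single plus_nc_word_def)
qed

lemma multilinear_keys:
  fixes f :: "'k::field nc_poly"
  assumes "multilinear m f" and "w \<in> Poly_Mapping.keys f"
  obtains \<sigma> where "\<sigma> permutes {1..m}" and "w = NC_Word (map \<sigma> [1..<Suc m])"
proof -
  from assms(1) obtain a where
    f: "f = (\<Sum>\<sigma> | \<sigma> permutes {1..m}. nc_const (a \<sigma>) * (\<Prod>i\<leftarrow>[1..<Suc m]. nc_var (\<sigma> i)))"
    unfolding multilinear_def by blast
  let ?S = "{\<sigma>. \<sigma> permutes {1..m}}"
    and ?t = "\<lambda>\<sigma>. Poly_Mapping.single (NC_Word (map \<sigma> [1..<Suc m])) (a \<sigma>)"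
  have "f = (\<Sum>\<sigma>\<in>?S. ?t \<sigma>)"
    unfolding f prod_list_nc_var nc_const_def mult_single by simp
  with assms(2) have "w \<in> Poly_Mapping.keys (sum ?t ?S)" by simp
  then have "w \<in> (\<Union>\<sigma>\<in>?S. Poly_Mapping.keys (?t \<sigma>))"
    by (rule subsetD[OF keys_sum])
  then obtain \<sigma> where "\<sigma> permutes {1..m}" and "w \<in> Poly_Mapping.keys (?t \<sigma>)" by blast
  then show thesis using that by (simp split: if_splits)
qed

lemma nc_word_eval_carrier:
  assumes "\<forall>i \<in> set (letters w). r i \<in> carrier_mat n n"
  shows "nc_word_eval (module_mat TYPE('k::field) n n) r w \<in> carrier_mat n n"
proof -
  have "foldr (\<lambda>i p. r i * p) xs (1\<^sub>m n) \<in> carrier_mat n n"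
    if "\<forall>i \<in> set xs. r i \<in> carrier_mat n n" for xs
    using that by (induction xs) auto
  with assms show ?thesis by (simp add: nc_word_eval_def module_mat_simps)
qed

text \<open>The support of a polynomial is only known to lie inside a set of words, since coefficients may
  vanish; summing over that whole set makes the evaluation an explicit formula.\<close>

lemma nc_eval_superset:
  fixes f :: "'k::field nc_poly"
  assumes W: "finite W" "Poly_Mapping.keys f \<subseteq> W"
    and r: "\<And>w i. w \<in> W \<Longrightarrow> i \<in> set (letters w) \<Longrightarrow> r i \<in> carrier_mat n n"
  defines "A \<equiv> module_mat TYPE('k) n n"
  shows "nc_eval A r f =
    (\<Oplus>\<^bsub>A\<^esub>w \<in> W. Poly_Mapping.lookup f w \<odot>\<^bsub>A\<^esub> nc_word_eval A r w)"
proof -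
  interpret abelian_group A unfolding A_def by (rule abelian_group_mat)
  have wc: "nc_word_eval A r w \<in> carrier_mat n n" if "w \<in> W" for w
    unfolding A_def using nc_word_eval_carrier r that by blast
  show ?thesis unfolding nc_eval_def
  proof (rule add.finprod_mono_neutral_cong_left[OF W])
    show "Poly_Mapping.lookup f i \<odot>\<^bsub>A\<^esub> nc_word_eval A r i = \<zero>\<^bsub>A\<^esub>" if "i \<in> W - Poly_Mapping.keys f" for i
      using wc[of i] that by (auto simp: A_def module_mat_simps in_keys_iff)
    show "(\<lambda>w. Poly_Mapping.lookup f w \<odot>\<^bsub>A\<^esub> nc_word_eval A r w) \<in> W \<rightarrow> carrier A"
      using wc by (auto simp: A_def module_mat_simps)
  qed auto
qed

text \<open>The next three lemmas replace polynomials by explicit expressions in the coefficients, so that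
  the rest of the argument concerns matrices only. Products are nested to the right because words
  are evaluated by a right fold.\<close>

lemma nc_values_1:
  fixes f :: "'k::field nc_poly"
  assumes "multilinear 1 f" and "f \<noteq> 0"
  obtains c where "c \<noteq> 0"
    and "\<And>x. x \<in> carrier_mat n n \<Longrightarrow> c \<cdot>\<^sub>m x \<in> nc_values (module_mat TYPE('k) n n) 1 f"
proof -
  let ?A = "module_mat TYPE('k) n n" and ?W = "{NC_Word [1]}"
  interpret abelian_group ?A by (rule abelian_group_mat)
  have keys: "Poly_Mapping.keys f \<subseteq> ?W"
  proof
    fix w assume wf: "w \<in> Poly_Mapping.keys f"
    obtain \<sigma> where s: "\<sigma> permutes {1..1}" and w: "w = NC_Word (map \<sigma> [1..<Suc 1])"
      by (rule multilinear_keys[OF assms(1) wf])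
    have "\<sigma> 1 = 1" using permutes_in_image[OF s, of 1] by simp
    then show "w \<in> ?W" unfolding w by simp
  qed
  show thesis
  proof
    show "Poly_Mapping.lookup f (NC_Word [1]) \<noteq> 0" 
    proof
      assume "Poly_Mapping.lookup f (NC_Word [1]) = 0"
      with keys have "w \<notin> Poly_Mapping.keys f" for w by (auto simp: in_keys_iff)
      then have "Poly_Mapping.keys f = {}" by blast
      with \<open>f \<noteq> 0\<close> show False by simp
    qed
    fix x :: "'k mat" assume x: "x \<in> carrier_mat n n"
    have "nc_eval ?A (\<lambda>_. x) f = Poly_Mapping.lookup f (NC_Word [1]) \<cdot>\<^sub>m x"
      using nc_eval_superset[OF _ keys, of "\<lambda>_. x" n] x
      by (simp add: nc_word_eval_def module_mat_simps)
    then show "Poly_Mapping.lookup f (NC_Word [1]) \<cdot>\<^sub>m x \<in> nc_values ?A 1 f"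
      unfolding nc_values_def using x
      by (intro CollectI exI[of _ "\<lambda>_. x"]) (simp add: module_mat_simps)
  qed
qed

lemma nc_values_2:
  fixes f :: "'k::field nc_poly"
  assumes "multilinear 2 f" and "f \<noteq> 0"
  obtains a b where "a \<noteq> 0 \<or> b \<noteq> 0"
    and "\<And>x y. x \<in> carrier_mat n n \<Longrightarrow> y \<in> carrier_mat n n \<Longrightarrow>
      a \<cdot>\<^sub>m (x * y) + b \<cdot>\<^sub>m (y * x) \<in> nc_values (module_mat TYPE('k) n n) 2 f"
proof -
  let ?A = "module_mat TYPE('k) n n" and ?W = "{NC_Word [1,2], NC_Word [2,1]}"
  let ?c = "\<lambda>xs. Poly_Mapping.lookup f (NC_Word xs)"
  interpret abelian_group ?A by (rule abelian_group_mat)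
  have keys: "Poly_Mapping.keys f \<subseteq> ?W"
  proof
    fix w assume wf: "w \<in> Poly_Mapping.keys f"
    obtain \<sigma> where s: "\<sigma> permutes {1..2}" and w: "w = NC_Word (map \<sigma> [1..<Suc 2])"
      by (rule multilinear_keys[OF assms(1) wf])
    have "\<sigma> 1 \<in> {1..2}" "\<sigma> 2 \<in> {1..2}" using permutes_in_image[OF s] by auto
    moreover have "\<sigma> 1 \<noteq> \<sigma> 2" by (simp_all add: inj_eq[OF permutes_inj[OF s]])
    moreover have "w = NC_Word [\<sigma> 1, \<sigma> 2]" unfolding w by (simp add: upt_rec numeral_eq_Suc)
    ultimately show "w \<in> ?W" by (auto simp: numeral_2_eq_2 le_Suc_eq)
  qed
  show thesis
  proof
    show "?c [1,2] \<noteq> 0 \<or> ?c [2,1] \<noteq> 0"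
    proof (rule ccontr)
      assume "\<not> ?thesis"
      with keys have "w \<notin> Poly_Mapping.keys f" for w by (auto simp: in_keys_iff)
      then have "Poly_Mapping.keys f = {}" by blast
      with \<open>f \<noteq> 0\<close> show False by simp
    qed
    fix x y :: "'k mat" assume xy: "x \<in> carrier_mat n n" "y \<in> carrier_mat n n"
    define r :: "nat \<Rightarrow> 'k mat" where "r = (\<lambda>i. if i = 1 then x else y)"
    have r: "r i \<in> carrier_mat n n" for i using xy by (simp add: r_def)
    have "nc_eval ?A r f = ?c [1,2] \<cdot>\<^sub>m (x * y) + ?c [2,1] \<cdot>\<^sub>m (y * x)"
      using nc_eval_superset[OF _ keys, of r n] r xy
      by (simp add: nc_word_eval_def module_mat_simps r_def)
    then show "?c [1,2] \<cdot>\<^sub>m (x * y) + ?c [2,1] \<cdot>\<^sub>m (y * x) \<in> nc_values ?A 2 f"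
      unfolding nc_values_def using r
      by (intro CollectI exI[of _ r]) (simp add: module_mat_simps)
  qed
qed

lemma nc_values_3:
  fixes f :: "'k::field nc_poly"
  assumes "multilinear 3 f" and "f \<noteq> 0"
  obtains c1 c2 c3 c4 c5 c6 where "\<not> (c1 = 0 \<and> c2 = 0 \<and> c3 = 0 \<and> c4 = 0 \<and> c5 = 0 \<and> c6 = 0)"
    and "\<And>x y z. x \<in> carrier_mat n n \<Longrightarrow> y \<in> carrier_mat n n \<Longrightarrow> z \<in> carrier_mat n n \<Longrightarrow>
      c1 \<cdot>\<^sub>m (x * (y * z)) + (c2 \<cdot>\<^sub>m (x * (z * y)) + (c3 \<cdot>\<^sub>m (y * (x * z)) +
      (c4 \<cdot>\<^sub>m (y * (z * x)) + (c5 \<cdot>\<^sub>m (z * (x * y)) + c6 \<cdot>\<^sub>m (z * (y * x))))))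
      \<in> nc_values (module_mat TYPE('k) n n) 3 f"
proof -
  let ?A = "module_mat TYPE('k) n n"
    and ?W = "{NC_Word [1,2,3], NC_Word [1,3,2], NC_Word [2,1,3], NC_Word [2,3,1],
      NC_Word [3,1,2], NC_Word [3,2,1]}"
  let ?c = "\<lambda>xs. Poly_Mapping.lookup f (NC_Word xs)"
  interpret abelian_group ?A by (rule abelian_group_mat)
  have keys: "Poly_Mapping.keys f \<subseteq> ?W"
  proof
    fix w assume wf: "w \<in> Poly_Mapping.keys f"
    obtain \<sigma> where s: "\<sigma> permutes {1..3}" and w: "w = NC_Word (map \<sigma> [1..<Suc 3])"
      by (rule multilinear_keys[OF assms(1) wf])
    have *: "i = 1 \<or> i = 2 \<or> i = 3" if "i \<in> {1..3}" for i :: nat using that by auto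
    have "\<sigma> 1 \<in> {1..3}" "\<sigma> 2 \<in> {1..3}" "\<sigma> 3 \<in> {1..3}" using permutes_in_image[OF s] by auto
    note this[THEN *]
    moreover have "\<sigma> 1 \<noteq> \<sigma> 2" "\<sigma> 1 \<noteq> \<sigma> 3" "\<sigma> 2 \<noteq> \<sigma> 3"
      by (simp_all add: inj_eq[OF permutes_inj[OF s]])
    moreover have "w = NC_Word [\<sigma> 1, \<sigma> 2, \<sigma> 3]" unfolding w by (simp add: upt_rec numeral_eq_Suc)
    ultimately show "w \<in> ?W" by (elim disjE) simp_all
  qed
  show thesis
  proof
    show "\<not> (?c [1,2,3] = 0 \<and> ?c [1,3,2] = 0 \<and> ?c [2,1,3] = 0 \<and> ?c [2,3,1] = 0 \<and>
      ?c [3,1,2] = 0 \<and> ?c [3,2,1] = 0)"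
    proof
      assume "?c [1,2,3] = 0 \<and> ?c [1,3,2] = 0 \<and> ?c [2,1,3] = 0 \<and> ?c [2,3,1] = 0 \<and>
        ?c [3,1,2] = 0 \<and> ?c [3,2,1] = 0"
      with keys have "w \<notin> Poly_Mapping.keys f" for w by (auto simp: in_keys_iff)
      then have "Poly_Mapping.keys f = {}" by blast
      with \<open>f \<noteq> 0\<close> show False by simp
    qed
    fix x y z :: "'k mat"
    assume xyz: "x \<in> carrier_mat n n" "y \<in> carrier_mat n n" "z \<in> carrier_mat n n"
    let ?v = "?c [1,2,3] \<cdot>\<^sub>m (x * (y * z)) + (?c [1,3,2] \<cdot>\<^sub>m (x * (z * y)) +
      (?c [2,1,3] \<cdot>\<^sub>m (y * (x * z)) + (?c [2,3,1] \<cdot>\<^sub>m (y * (z * x)) +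
      (?c [3,1,2] \<cdot>\<^sub>m (z * (x * y)) + ?c [3,2,1] \<cdot>\<^sub>m (z * (y * x))))))"
    define r :: "nat \<Rightarrow> 'k mat" where "r = (\<lambda>i. if i = 1 then x else if i = 2 then y else z)"
    have r: "r i \<in> carrier_mat n n" for i using xyz by (simp add: r_def)
    have "nc_eval ?A r f = ?v"
      using nc_eval_superset[OF _ keys, of r n] r xyz
      by (simp add: nc_word_eval_def module_mat_simps r_def)
    then show "?v \<in> nc_values ?A 3 f"
      unfolding nc_values_def using r
      by (intro CollectI exI[of _ r]) (simp add: module_mat_simps)
  qed
qed

section \<open>Similarity to a matrix with zero diagonal\<close>

text \<open>The diagonal is cleared from the top by elementary conjugations, that is, a row operation together
  with the inverse column operation. An operation on indices \<open>\<ge> k\<close> leaves the first \<open>k\<close> diagonal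
  entries alone, so what has to survive a step is that the trailing block can still be worked with:
  it must not be a scalar matrix.\<close>

definition nonscalar_from :: "nat \<Rightarrow> 'a::zero mat \<Rightarrow> bool" where
  "nonscalar_from k M \<longleftrightarrow> (\<exists>i j. k \<le> i \<and> i < dim_row M \<and> k \<le> j \<and> j < dim_row M \<and> i \<noteq> j \<and>
    (M $$ (i, j) \<noteq> 0 \<or> M $$ (i, i) \<noteq> M $$ (j, j)))"

text \<open>The pivot used for clearing the entry \<open>(k, k)\<close> sits below it in its column. If the
  block is diagonal with \<open>M $$ (i, i) \<noteq> M $$ (j, j)\<close>, one elementary conjugation puts the difference of
  these two entries into position \<open>(i, j)\<close>; a transposition then moves a nonzero off-diagonal entry
  into column \<open>k\<close>.\<close>

lemma nonscalar_fromE: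
  fixes M :: "'a::field mat"
  assumes M: "M \<in> carrier_mat n n" and ns: "nonscalar_from k M"
  obtains N p where "similar_mat N M" "N \<in> carrier_mat n n" "k < p" "p < n" "N $$ (p, k) \<noteq> 0"
    and "\<And>l. l < k \<Longrightarrow> N $$ (l, l) = M $$ (l, l)"
proof -
  from ns M obtain i j where ij: "k \<le> i" "i < n" "k \<le> j" "j < n" "i \<noteq> j"
    and nz: "M $$ (i, j) \<noteq> 0 \<or> M $$ (i, i) \<noteq> M $$ (j, j)"
    unfolding nonscalar_from_def by auto
  obtain N i j where N: "similar_mat N M" "N \<in> carrier_mat n n"
    and ij: "k \<le> i" "i < n" "k \<le> j" "j < n" "i \<noteq> j" and nz: "N $$ (i, j) \<noteq> 0"
    and pres: "\<And>l. l < k \<Longrightarrow> N $$ (l, l) = M $$ (l, l)"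
  proof -
    consider "M $$ (i, j) \<noteq> 0" | "M $$ (j, i) \<noteq> 0"
      | "M $$ (i, j) = 0" "M $$ (j, i) = 0" "M $$ (i, i) \<noteq> M $$ (j, j)" using nz by blast
    then show thesis
    proof cases
      case 1 show thesis using that[OF similar_mat_refl[OF M] M ij 1] by simp
    next
      case 2 show thesis using that[OF similar_mat_refl[OF M] M _ _ _ _ _ 2] ij by simp
    next
      case 3
      show thesis
        by (rule that[OF add_col_sub_row_similar[OF M, of i j 1] _ ij]) (use M ij 3 in auto)
    qed
  qed
  define N' where "N' = swap_cols_rows k j N"
  have N': "similar_mat N' N" "N' \<in> carrier_mat n n"
    unfolding N'_def using swap_cols_rows_similar[OF N(2), of k j] N(2) ij by auto
  show thesis
  proof (rule that[of N' "if i = k then j else i"])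
    show "similar_mat N' M" using similar_mat_trans[OF N'(1) N(1)] .
    show "N' $$ (if i = k then j else i, k) \<noteq> 0"
      using N(2) ij nz unfolding N'_def by auto
    show "N' $$ (l, l) = M $$ (l, l)" if "l < k" for l
      using N(2) ij pres[OF that] that unfolding N'_def by auto
  qed (use N'(2) ij in auto)
qed

text \<open>Clearing the entry \<open>(k, k)\<close> with the pivot \<open>(p, k)\<close> may leave a scalar block behind, for
  which the process would stop. The freedom to subtract column \<open>k\<close> from another column \<open>q\<close> repairs
  this: it puts the pivot, up to sign, into position \<open>(p, q)\<close>.\<close>

lemma clear_diagonal_entry:
  fixes M :: "'a::field mat"
  assumes M: "M \<in> carrier_mat n n" and ns: "nonscalar_from k M"
    and zero: "\<And>l. l < k \<Longrightarrow> M $$ (l, l) = 0"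
  obtains N where "similar_mat N M" "N \<in> carrier_mat n n"
    and "\<And>l. l \<le> k \<Longrightarrow> N $$ (l, l) = 0" and "Suc (Suc k) < n \<Longrightarrow> nonscalar_from (Suc k) N"
proof -
  obtain N0 p where N0: "similar_mat N0 M" "N0 \<in> carrier_mat n n" and p: "k < p" "p < n"
    and pk0: "N0 $$ (p, k) \<noteq> 0" and d0: "\<And>l. l < k \<Longrightarrow> N0 $$ (l, l) = 0"
    using nonscalar_fromE[OF M ns] zero by metis
  define N1 where "N1 = add_col_sub_row (N0 $$ (k, k) / N0 $$ (p, k)) k p N0"
  have N1: "similar_mat N1 M" "N1 \<in> carrier_mat n n"
    unfolding N1_def
    using similar_mat_trans[OF add_col_sub_row_similar[OF N0(2), of k p] N0(1)] N0(2) p by auto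
  have pk1: "N1 $$ (p, k) \<noteq> 0" and d1: "\<And>l. l \<le> k \<Longrightarrow> N1 $$ (l, l) = 0"
    using N0(2) p pk0 d0 unfolding N1_def by auto
  show thesis
  proof (cases "Suc (Suc k) < n \<longrightarrow> nonscalar_from (Suc k) N1")
    case True
    then show thesis using that[OF N1 d1] by blast
  next
    case False
    then have "Suc (Suc k) < n" and sc: "\<not> nonscalar_from (Suc k) N1" by auto
    obtain q where q: "k < q" "q < n" "q \<noteq> p"
      using \<open>Suc (Suc k) < n\<close> p
      by (metis Suc_lessD lessI less_SucI n_not_Suc_n)
    have pq1: "N1 $$ (p, q) = 0"
      using sc N1(2) p q unfolding nonscalar_from_def
      by (metis Suc_leI carrier_matD(1))
    \<comment> \<open>Clear \<open>(q, k)\<close> first: the next operation adds this entry to \<open>(k, k)\<close>, which has to stay zero.\<close>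
    define N2 where "N2 = add_col_sub_row (N1 $$ (q, k) / N1 $$ (p, k)) q p N1"
    have N2: "similar_mat N2 M" "N2 \<in> carrier_mat n n"
      unfolding N2_def
      using similar_mat_trans[OF add_col_sub_row_similar[OF N1(2), of q p] N1(1)] N1(2) p q by auto
    have e2: "N2 $$ (p, k) \<noteq> 0" "N2 $$ (q, k) = 0" "N2 $$ (p, q) = 0"
      "\<And>l. l \<le> k \<Longrightarrow> N2 $$ (l, l) = 0"
      using N1(2) p q pk1 d1 pq1 unfolding N2_def by auto
    define N3 where "N3 = add_col_sub_row 1 k q N2"
    have N3: "similar_mat N3 M" "N3 \<in> carrier_mat n n"
      unfolding N3_def
      using similar_mat_trans[OF add_col_sub_row_similar[OF N2(2), of k q] N2(1)] N2(2) p q by auto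
    have e3: "N3 $$ (p, q) \<noteq> 0" "\<And>l. l \<le> k \<Longrightarrow> N3 $$ (l, l) = 0"
      using N2(2) p q e2 unfolding N3_def by auto
    have "nonscalar_from (Suc k) N3"
      unfolding nonscalar_from_def using e3(1) p q N3(2) by (metis Suc_leI carrier_matD(1))
    with that[OF N3 e3(2)] show thesis by blast
  qed
qed

lemma mat_trace_mult_commute:
  fixes A B :: "'a::comm_ring_1 mat"
  assumes "A \<in> carrier_mat n n" and "B \<in> carrier_mat n n"
  shows "mat_trace (A * B) = mat_trace (B * A)"
proof -
  have "mat_trace (A * B) = (\<Sum>i<n. \<Sum>k<n. A $$ (i, k) * B $$ (k, i))"
    using assms by (simp add: mat_trace_def scalar_prod_def lessThan_atLeast0)
  also have "\<dots> = (\<Sum>k<n. \<Sum>i<n. B $$ (k, i) * A $$ (i, k))"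
    by (subst sum.swap) (simp add: mult.commute)
  also have "\<dots> = mat_trace (B * A)"
    using assms by (simp add: mat_trace_def scalar_prod_def lessThan_atLeast0)
  finally show ?thesis .
qed

lemma mat_trace_similar:
  fixes A B :: "'a::comm_ring_1 mat"
  assumes "similar_mat A B"
  shows "mat_trace A = mat_trace B"
proof -
  obtain n P Q where c: "{A, B, P, Q} \<subseteq> carrier_mat n n" and QP: "Q * P = 1\<^sub>m n"
    and A: "A = P * B * Q" using similar_matD[OF assms] by blast
  have "mat_trace A = mat_trace (Q * (P * B))"
    unfolding A using mat_trace_mult_commute[of "P * B" n Q] c by auto
  also have "Q * (P * B) = (Q * P) * B" using c by (auto simp: assoc_mult_mat[of _ n n _ n _ n])
  also have "\<dots> = B" using QP c by auto
  finally show ?thesis .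
qed

text \<open>Clearing stops at the last diagonal entry, where the block has size one; that entry is the
  trace.\<close>

lemma similar_zero_diagonal:
  fixes M :: "'a::field mat"
  assumes M: "M \<in> carrier_mat n n" and tr: "mat_trace M = 0" and ns: "nonscalar_from 0 M"
  obtains N where "similar_mat N M" "N \<in> carrier_mat n n" "\<And>i. i < n \<Longrightarrow> N $$ (i, i) = 0"
proof -
  have "n > 0" using ns M by (auto simp: nonscalar_from_def)
  \<comment> \<open>A trailing block of size one is always scalar, hence the guard \<open>Suc k < n\<close>.\<close>
  have "\<exists>N. similar_mat N M \<and> N \<in> carrier_mat n n \<and> (\<forall>l<k. N $$ (l, l) = 0) \<and>
      (Suc k < n \<longrightarrow> nonscalar_from k N)" if "k < n" for k
    using that
  proof (induction k)
    case 0
    show ?case using M ns similar_mat_refl[OF M] by blast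
  next
    case (Suc k)
    then obtain N where N: "similar_mat N M" "N \<in> carrier_mat n n" "\<And>l. l < k \<Longrightarrow> N $$ (l, l) = 0"
      "nonscalar_from k N" by auto
    obtain N' where N': "similar_mat N' N" "N' \<in> carrier_mat n n"
      "\<And>l. l \<le> k \<Longrightarrow> N' $$ (l, l) = 0" "Suc (Suc k) < n \<Longrightarrow> nonscalar_from (Suc k) N'"
      using clear_diagonal_entry[OF N(2,4,3)] by blast
    show ?case
      using N'(2-4) similar_mat_trans[OF N'(1) N(1)] by (auto simp: less_Suc_eq_le)
  qed
  from this[of "n - 1"] \<open>n > 0\<close> obtain N where N: "similar_mat N M" "N \<in> carrier_mat n n"
    "\<And>l. l < n - 1 \<Longrightarrow> N $$ (l, l) = 0" by auto
  have "0 = (\<Sum>i<n. N $$ (i, i))"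
    using mat_trace_similar[OF N(1)] tr N(2) by (simp add: mat_trace_def)
  also have "\<dots> = N $$ (n - 1, n - 1)"
    using \<open>n > 0\<close> N(3) by (cases n) auto
  finally have "N $$ (i, i) = 0" if "i < n" for i
    using N(3)[of i] that by (cases "i = n - 1") auto
  with N(1,2) show thesis using that by blast
qed

section \<open>Lie polynomials of degree three\<close>

definition lie_bracket :: "'a::ring_1 mat \<Rightarrow> 'a mat \<Rightarrow> 'a mat" where
  "lie_bracket X Y = X * Y - Y * X"

lemma lie_bracket_carrier [simp]:
  "X \<in> carrier_mat n n \<Longrightarrow> Y \<in> carrier_mat n n \<Longrightarrow> lie_bracket X Y \<in> carrier_mat n n"
  by (auto simp: lie_bracket_def)

lemma lie_bracket_conjugate:
  fixes X Y :: "'a::ring_1 mat"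
  assumes X: "X \<in> carrier_mat n n" and Y: "Y \<in> carrier_mat n n"
    and P: "P \<in> carrier_mat n n" and Q: "Q \<in> carrier_mat n n" and QP: "Q * P = 1\<^sub>m n"
  shows "lie_bracket (P * X * Q) (P * Y * Q) = P * lie_bracket X Y * Q"
proof -
  have *: "P * X * Q * (P * Y * Q) = P * (X * Y) * Q"
    if X: "X \<in> carrier_mat n n" and Y: "Y \<in> carrier_mat n n" for X Y
  proof -
    have "P * X * Q * (P * Y * Q) = P * X * ((Q * P) * (Y * Q))"
      using X Y P Q by (simp add: assoc_mult_mat[of _ n n _ n _ n])
    also have "\<dots> = P * (X * Y) * Q"
      unfolding QP using X Y P Q by (simp add: assoc_mult_mat[of _ n n _ n _ n])
    finally show ?thesis .
  qed
  show ?thesis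
    unfolding lie_bracket_def *[OF X Y] *[OF Y X]
    using X Y P Q
    by (simp add: mult_minus_distrib_mat[of _ n n _ n] minus_mult_distrib_mat[of _ n n _ _ n])
qed

text \<open>By the Jacobi identity the two terms span all multilinear Lie polynomials in three variables.\<close>

definition double_bracket :: "'a::ring_1 \<Rightarrow> 'a \<Rightarrow> 'a mat \<Rightarrow> 'a mat \<Rightarrow> 'a mat \<Rightarrow> 'a mat" where
  "double_bracket c d x y z =
    c \<cdot>\<^sub>m lie_bracket x (lie_bracket y z) + d \<cdot>\<^sub>m lie_bracket y (lie_bracket x z)"

lemma double_bracket_conjugate:
  fixes x y z :: "'a::field mat"
  assumes "x \<in> carrier_mat n n" and "y \<in> carrier_mat n n" and "z \<in> carrier_mat n n"
    and "P \<in> carrier_mat n n" and "Q \<in> carrier_mat n n" and "Q * P = 1\<^sub>m n"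
  shows "double_bracket c d (P * x * Q) (P * y * Q) (P * z * Q) = P * double_bracket c d x y z * Q"
  unfolding double_bracket_def
  using assms
  by (simp add: lie_bracket_conjugate mult_add_distrib_mat[of _ n n _ n] add_mult_distrib_mat[of _ n n _ _ n]
      mult_smult_distrib[of _ n n _ n] mult_smult_assoc_mat[of _ n n _ n] del: assoc_mult_mat)

text \<open>Distinct entries \<open>e i\<close> are what makes \<open>y \<mapsto> [D, [y, D]]\<close> invertible off the diagonal; taking \<open>D\<close>
  for both \<open>x\<close> and \<open>z\<close> removes the term with coefficient \<open>d\<close>.\<close>

lemma double_bracket_zero_diagonal:
  fixes T :: "'a::field mat"
  assumes T: "T \<in> carrier_mat n n" and diag: "\<And>i. i < n \<Longrightarrow> T $$ (i, i) = 0"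
    and field: "infinite (UNIV :: 'a set) \<or> card (UNIV :: 'a set) \<ge> n" and c: "c \<noteq> 0"
  obtains x y z where "x \<in> carrier_mat n n" "y \<in> carrier_mat n n" "z \<in> carrier_mat n n"
    and "double_bracket c d x y z = T"
proof -
  obtain e :: "nat \<Rightarrow> 'a" where e: "inj_on e {..<n}"
  proof (cases "finite (UNIV :: 'a set)")
    case True
    with field show thesis using card_le_inj[of "{..<n}" "UNIV :: 'a set"] that by auto
  next
    case False
    then show thesis using infinite_countable_subset that
      by (metis inj_on_subset subset_UNIV)
  qed
  define D where "D = mat_diag n e"
  \<comment> \<open>On the diagonal the denominator is 0, and so is the quotient.\<close>
  define y where "y = mat n n (\<lambda>(i, j). T $$ (i, j) / (c * (e i - e j) * (e j - e i)))"
  have Dc: "D \<in> carrier_mat n n" and yc: "y \<in> carrier_mat n n" by (auto simp: D_def y_def)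
  have DX: "D * X = mat n n (\<lambda>(i, j). e i * X $$ (i, j))"
    and XD: "X * D = mat n n (\<lambda>(i, j). X $$ (i, j) * e j)" if "X \<in> carrier_mat n n" for X
    unfolding D_def using mat_diag_mult_left[OF that] mat_diag_mult_right[OF that] by auto
  have DD: "lie_bracket D D = 0\<^sub>m n n" using Dc by (simp add: lie_bracket_def)
  have "double_bracket c d D y D = T"
  proof (rule eq_matI)
    fix i j assume "i < dim_row T" "j < dim_col T"
    with T have ij: "i < n" "j < n" by auto
    have ne: "e i \<noteq> e j" if "i \<noteq> j" using e ij that by (auto dest: inj_onD)
    have yD: "lie_bracket y D \<in> carrier_mat n n" using yc Dc by simp
    have "double_bracket c d D y D $$ (i, j) = c * (e i - e j) * (e j - e i) * y $$ (i, j)"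
      unfolding double_bracket_def DD
      using ij yc Dc yD
      by (simp add: lie_bracket_def DX XD) (simp add: algebra_simps)
    also have "\<dots> = T $$ (i, j)"
      using ij ne c diag[of i] by (cases "i = j") (auto simp: y_def)
    finally show "double_bracket c d D y D $$ (i, j) = T $$ (i, j)" .
  qed (use T Dc yc in \<open>auto simp: double_bracket_def lie_bracket_def\<close>)
  with that[OF Dc yc Dc] show thesis by blast
qed

text \<open>In the basis \<open>1, t, \<dots>, t\<^sup>n\<^sup>-\<^sup>1\<close> of \<open>K[t]/(t\<^sup>n)\<close>, the matrices below are \<open>(\<mu>/c) \<partial>\<close>, the Euler operator
  \<open>t \<partial>\<close> and multiplication by \<open>t\<close>. The first of them is well
  defined on the quotient because \<open>n \<mu> = 0\<close>.\<close>

lemma double_bracket_scalar: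
  fixes \<mu> :: "'a::field"
  assumes tr: "of_nat n * \<mu> = 0" and c: "c \<noteq> 0"
  obtains x y z where "x \<in> carrier_mat n n" "y \<in> carrier_mat n n" "z \<in> carrier_mat n n"
    and "double_bracket c d x y z = \<mu> \<cdot>\<^sub>m 1\<^sub>m n"
proof -
  define x where "x = mat n n (\<lambda>(i, j). if j = Suc i then of_nat j * (\<mu> / c) else 0)"
  define y :: "'a mat" where "y = mat_diag n of_nat"
  define z :: "'a mat" where "z = mat n n (\<lambda>(i, j). if i = Suc j then 1 else 0)"
  have cs: "x \<in> carrier_mat n n" "y \<in> carrier_mat n n" "z \<in> carrier_mat n n"
    by (auto simp: x_def y_def z_def)
  have yz: "lie_bracket y z = z"
    unfolding lie_bracket_def y_def mat_diag_mult_left[OF cs(3)] mat_diag_mult_right[OF cs(3)]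
    by (rule eq_matI) (auto simp: z_def)
  have tr': "of_nat n * (\<mu> / c) = 0" using tr by simp
  have xz: "lie_bracket x z = (\<mu> / c) \<cdot>\<^sub>m 1\<^sub>m n"
  proof (rule eq_matI)
    fix i j assume "i < dim_row ((\<mu> / c) \<cdot>\<^sub>m 1\<^sub>m n :: 'a mat)" "j < dim_col ((\<mu> / c) \<cdot>\<^sub>m 1\<^sub>m n :: 'a mat)"
    then have ij: "i < n" "j < n" by auto
    have "(x * z) $$ (i, j) = (\<Sum>k<n. x $$ (i, k) * z $$ (k, j))"
      using ij cs by (simp add: scalar_prod_def lessThan_atLeast0)
    also have "\<dots> = (\<Sum>k<n. (if k = Suc i then of_nat k * (\<mu> / c) * (if k = Suc j then 1 else 0) else 0))"
      by (intro sum.cong) (use ij in \<open>auto simp: x_def z_def\<close>)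
    also have "\<dots> = (if i = j \<and> Suc i < n then of_nat (Suc i) * (\<mu> / c) else 0)"
      by (subst sum.delta) auto
    finally have 1: "(x * z) $$ (i, j) = \<dots>" .
    have "(z * x) $$ (i, j) = (\<Sum>k<n. z $$ (i, k) * x $$ (k, j))"
      using ij cs by (simp add: scalar_prod_def lessThan_atLeast0)
    also have "\<dots> = (\<Sum>k<n. (if k = i - 1 then (if i = Suc k \<and> j = Suc k then of_nat j * (\<mu> / c) else 0) else 0))"
    proof (intro sum.cong refl)
      fix k assume "k \<in> {..<n}"
      then show "z $$ (i, k) * x $$ (k, j) =
          (if k = i - 1 then (if i = Suc k \<and> j = Suc k then of_nat j * (\<mu> / c) else 0) else 0)"
        using ij by (cases i) (auto simp: x_def z_def)
    qed
    also have "\<dots> = (if i = j then of_nat i * (\<mu> / c) else 0)"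
      using ij by (subst sum.delta) (auto simp: not_less_eq gr0_conv_Suc, cases j, auto)
    finally have 2: "(z * x) $$ (i, j) = \<dots>" .
    \<comment> \<open>The last row lacks its term in \<open>x * z\<close>; that term would be \<open>n \<mu> / c = 0\<close>.\<close>
    have 3: "Suc i = n" if "\<not> Suc i < n" using ij that by simp
    have 4: "of_nat (Suc i) * (\<mu> / c) = 0" if "\<not> Suc i < n" using tr' 3[OF that] by simp
    have "(if i = j \<and> Suc i < n then of_nat (Suc i) * (\<mu> / c) else 0) = (if i = j then of_nat (Suc i) * (\<mu> / c) else 0)"
      using 4 by auto
    note 1 = 1[unfolded this]
    have "lie_bracket x z $$ (i, j) = (x * z) $$ (i, j) - (z * x) $$ (i, j)"
      using ij cs by (simp add: lie_bracket_def del: index_mult_mat(1))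
    also have "\<dots> = ((\<mu> / c) \<cdot>\<^sub>m 1\<^sub>m n) $$ (i, j)"
      unfolding 1 2 using ij by (simp add: algebra_simps add_divide_distrib)
    finally show "lie_bracket x z $$ (i, j) = ((\<mu> / c) \<cdot>\<^sub>m 1\<^sub>m n) $$ (i, j)" .
  qed (use cs in \<open>auto simp: lie_bracket_def\<close>)
  have y1: "lie_bracket y (lie_bracket x z) = 0\<^sub>m n n"
    unfolding xz unfolding lie_bracket_def using cs(2)
    by (simp add: mult_smult_distrib[of _ n n _ n] mult_smult_assoc_mat[of _ n n _ n])
  have "double_bracket c d x y z = \<mu> \<cdot>\<^sub>m 1\<^sub>m n"
    unfolding double_bracket_def yz y1 unfolding xz using c by (intro eq_matI) auto
  with that[OF cs] show thesis by blast
qed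

lemma double_bracket_trace_zero:
  fixes T :: "'a::field mat"
  assumes T: "T \<in> carrier_mat n n" and tr: "mat_trace T = 0"
    and field: "infinite (UNIV :: 'a set) \<or> card (UNIV :: 'a set) \<ge> n" and c: "c \<noteq> 0"
  obtains x y z where "x \<in> carrier_mat n n" "y \<in> carrier_mat n n" "z \<in> carrier_mat n n"
    and "double_bracket c d x y z = T"
proof (cases "nonscalar_from 0 T")
  case True
  obtain N where N: "similar_mat N T" "N \<in> carrier_mat n n" "\<And>i. i < n \<Longrightarrow> N $$ (i, i) = 0"
    using similar_zero_diagonal[OF T tr True] by blast
  obtain P Q where PQ: "similar_mat_wit T N P Q"
    using similar_mat_sym[OF N(1)] unfolding similar_mat_def by blast
  note w = similar_mat_witD2[OF T PQ]
  obtain x y z where xyz: "x \<in> carrier_mat n n" "y \<in> carrier_mat n n" "z \<in> carrier_mat n n"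
    "double_bracket c d x y z = N"
    using double_bracket_zero_diagonal[OF N(2,3) field c] by blast
  show thesis
  proof (rule that)
    show "double_bracket c d (P * x * Q) (P * y * Q) (P * z * Q) = T"
      using double_bracket_conjugate[OF xyz(1-3) w(6,7,2)] xyz(4) w(3) by simp
  qed (use w xyz in auto)
next
  case False
  have T0: "T = T $$ (0, 0) \<cdot>\<^sub>m 1\<^sub>m n"
  proof (rule eq_matI)
    fix i j assume "i < dim_row (T $$ (0, 0) \<cdot>\<^sub>m 1\<^sub>m n)" "j < dim_col (T $$ (0, 0) \<cdot>\<^sub>m 1\<^sub>m n)"
    then have ij: "i < n" "j < n" by auto
    then have "i \<noteq> j \<Longrightarrow> T $$ (i, j) = 0"
      using False T by (auto simp: nonscalar_from_def)
    moreover have "T $$ (i, i) = T $$ (0, 0)"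
      using False T ij by (cases "i = 0") (auto simp: nonscalar_from_def)
    ultimately show "T $$ (i, j) = (T $$ (0, 0) \<cdot>\<^sub>m 1\<^sub>m n) $$ (i, j)" using ij by auto
  qed (use T in auto)
  have "mat_trace T = of_nat n * T $$ (0, 0)"
    by (subst T0) (simp add: mat_trace_def)
  with tr have "of_nat n * T $$ (0, 0) = 0" by simp
  from double_bracket_scalar[OF this c] T0 that show thesis by metis
qed

lemma double_bracket_swap:
  assumes "x \<in> carrier_mat n n" "y \<in> carrier_mat n n" "z \<in> carrier_mat n n"
  shows "double_bracket c d x y z = double_bracket d c y x z"
  unfolding double_bracket_def using assms by (auto intro!: comm_add_mat[of _ n n])

lemma lie_bracket_trace_zero:
  fixes T :: "'a::field mat"
  assumes T: "T \<in> carrier_mat n n" and tr: "mat_trace T = 0"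
    and field: "infinite (UNIV :: 'a set) \<or> card (UNIV :: 'a set) \<ge> n"
  obtains x y where "x \<in> carrier_mat n n" "y \<in> carrier_mat n n" "lie_bracket x y = T"
proof -
  obtain x y z where c: "x \<in> carrier_mat n n" "y \<in> carrier_mat n n" "z \<in> carrier_mat n n"
    and "double_bracket 1 0 x y z = T"
    using double_bracket_trace_zero[OF T tr field, of 1 0] by auto
  moreover have "1 \<cdot>\<^sub>m A + 0 \<cdot>\<^sub>m B = A"
    if "A \<in> carrier_mat n n" "B \<in> carrier_mat n n" for A B :: "'a mat"
    using that by (intro eq_matI) auto
  ultimately have "lie_bracket x (lie_bracket y z) = T"
    by (simp add: double_bracket_def)
  with c that show thesis by (metis lie_bracket_carrier)
qed

section \<open>Multilinear polynomials of degree two and three\<close>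

lemma degree_two_value:
  fixes T :: "'a::field mat"
  assumes T: "T \<in> carrier_mat n n" and tr: "mat_trace T = 0"
    and field: "infinite (UNIV :: 'a set) \<or> card (UNIV :: 'a set) \<ge> n" and ab: "a \<noteq> 0 \<or> b \<noteq> 0"
  obtains x y where "x \<in> carrier_mat n n" "y \<in> carrier_mat n n"
    and "a \<cdot>\<^sub>m (x * y) + b \<cdot>\<^sub>m (y * x) = T"
proof (cases "a + b = 0")
  case True
  then have b: "b = - a" by (simp add: eq_neg_iff_add_eq_0 add.commute)
  with ab have a: "a \<noteq> 0" by simp
  have "mat_trace (inverse a \<cdot>\<^sub>m T) = 0"
    using tr T by (simp add: mat_trace_def flip: sum_distrib_left)
  with T field obtain x y where xy: "x \<in> carrier_mat n n" "y \<in> carrier_mat n n"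
    "lie_bracket x y = inverse a \<cdot>\<^sub>m T"
    using lie_bracket_trace_zero[of "inverse a \<cdot>\<^sub>m T" n] by auto
  have "a \<cdot>\<^sub>m (x * y) + b \<cdot>\<^sub>m (y * x) = a \<cdot>\<^sub>m lie_bracket x y"
    unfolding b lie_bracket_def using xy(1,2)
    by (intro eq_matI) (auto simp: algebra_simps simp del: index_mult_mat(1))
  also have "\<dots> = T" unfolding xy(3) using a T by (intro eq_matI) auto
  finally show thesis using that xy by blast
next
  case False
  have scale: "a * (inverse (a + b) * t) + b * (inverse (a + b) * t) = t" for t
  proof -
    have "a * (inverse (a + b) * t) + b * (inverse (a + b) * t) = (a + b) * inverse (a + b) * t"
      by (simp only: distrib_right mult.assoc)
    with False show ?thesis by simp
  qed
  show thesis
  proof (rule that)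
    show "a \<cdot>\<^sub>m (1\<^sub>m n * (inverse (a + b) \<cdot>\<^sub>m T)) + b \<cdot>\<^sub>m ((inverse (a + b) \<cdot>\<^sub>m T) * 1\<^sub>m n) = T"
      using T by (intro eq_matI) (auto simp: scale)
  qed (use T in auto)
qed

text \<open>The four equations obtained when a substitution of the identity gives nothing express all
  coefficients through \<open>c1\<close> and \<open>c3\<close>, and the polynomial becomes \<open>c1 [x, [y, z]] + c3 [y, [x, z]]\<close>.\<close>

lemma degree_three_value:
  fixes T :: "'a::field mat"
  assumes T: "T \<in> carrier_mat n n" and tr: "mat_trace T = 0"
    and field: "infinite (UNIV :: 'a set) \<or> card (UNIV :: 'a set) \<ge> n"
    and nz: "\<not> (c1 = 0 \<and> c2 = 0 \<and> c3 = 0 \<and> c4 = 0 \<and> c5 = 0 \<and> c6 = 0)"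
  obtains x y z where "x \<in> carrier_mat n n" "y \<in> carrier_mat n n" "z \<in> carrier_mat n n"
    and "c1 \<cdot>\<^sub>m (x * (y * z)) + (c2 \<cdot>\<^sub>m (x * (z * y)) + (c3 \<cdot>\<^sub>m (y * (x * z)) +
      (c4 \<cdot>\<^sub>m (y * (z * x)) + (c5 \<cdot>\<^sub>m (z * (x * y)) + c6 \<cdot>\<^sub>m (z * (y * x)))))) = T"
proof -
  define g where "g x y z = c1 \<cdot>\<^sub>m (x * (y * z)) + (c2 \<cdot>\<^sub>m (x * (z * y)) + (c3 \<cdot>\<^sub>m (y * (x * z)) +
      (c4 \<cdot>\<^sub>m (y * (z * x)) + (c5 \<cdot>\<^sub>m (z * (x * y)) + c6 \<cdot>\<^sub>m (z * (y * x))))))" for x y z :: "'a mat"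
  have gx: "g (1\<^sub>m n) u v = (c1 + c3 + c4) \<cdot>\<^sub>m (u * v) + (c2 + c5 + c6) \<cdot>\<^sub>m (v * u)"
    and gy: "g u (1\<^sub>m n) v = (c1 + c2 + c3) \<cdot>\<^sub>m (u * v) + (c4 + c5 + c6) \<cdot>\<^sub>m (v * u)"
    and gz: "g u v (1\<^sub>m n) = (c1 + c2 + c5) \<cdot>\<^sub>m (u * v) + (c3 + c4 + c6) \<cdot>\<^sub>m (v * u)"
    if "u \<in> carrier_mat n n" "v \<in> carrier_mat n n" for u v
    unfolding g_def using that
    by (auto intro!: eq_matI simp: algebra_simps simp del: index_mult_mat(1))
  have one: "1\<^sub>m n \<in> carrier_mat n n" by simp
  have "\<exists>x y z. x \<in> carrier_mat n n \<and> y \<in> carrier_mat n n \<and> z \<in> carrier_mat n n \<and> g x y z = T"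
  proof -
    consider "c1 + c3 + c4 \<noteq> 0 \<or> c2 + c5 + c6 \<noteq> 0" | "c1 + c2 + c3 \<noteq> 0 \<or> c4 + c5 + c6 \<noteq> 0"
      | "c1 + c2 + c5 \<noteq> 0 \<or> c3 + c4 + c6 \<noteq> 0"
      | "c1 + c3 + c4 = 0" "c1 + c2 + c3 = 0" "c1 + c2 + c5 = 0" "c3 + c4 + c6 = 0"
      by blast
    then show ?thesis
    proof cases
      case 1
      obtain x y where "x \<in> carrier_mat n n" "y \<in> carrier_mat n n" "g (1\<^sub>m n) x y = T"
        using degree_two_value[OF T tr field 1] gx by auto
      with one show ?thesis by blast
    next
      case 2
      obtain x y where "x \<in> carrier_mat n n" "y \<in> carrier_mat n n" "g x (1\<^sub>m n) y = T"
        using degree_two_value[OF T tr field 2] gy by auto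
      with one show ?thesis by blast
    next
      case 3
      obtain x y where "x \<in> carrier_mat n n" "y \<in> carrier_mat n n" "g x y (1\<^sub>m n) = T"
        using degree_two_value[OF T tr field 3] gz by auto
      with one show ?thesis by blast
    next
      case 4
      have c4: "c4 = - c1 - c3" using 4(1) by (simp add: algebra_simps eq_neg_iff_add_eq_0)
      have c2: "c2 = - c1 - c3" using 4(2) by (simp add: algebra_simps eq_neg_iff_add_eq_0)
      have c5: "c5 = c3" using 4(3) by (simp add: c2)
      have c6: "c6 = c1" using 4(4) by (simp add: c4)
      have g: "g x y z = double_bracket c1 c3 x y z"
        if "x \<in> carrier_mat n n" "y \<in> carrier_mat n n" "z \<in> carrier_mat n n" for x y z
        unfolding g_def double_bracket_def lie_bracket_def c2 c4 c5 c6 using that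
        by (simp add: mult_minus_distrib_mat[of _ n n _ n] minus_mult_distrib_mat[of _ n n _ _ n]
            assoc_mult_mat[of _ n n _ n _ n])
          (auto intro!: eq_matI simp: algebra_simps simp del: index_mult_mat(1))
      show ?thesis
      proof (cases "c1 = 0")
        case False
        obtain x y z where "x \<in> carrier_mat n n" "y \<in> carrier_mat n n" "z \<in> carrier_mat n n"
          "double_bracket c1 c3 x y z = T"
          by (rule double_bracket_trace_zero[OF T tr field False])
        with g show ?thesis by blast
      next
        case True
        with nz have "c3 \<noteq> 0" by (auto simp: c2 c4 c5 c6)
        obtain x y z where xyz: "x \<in> carrier_mat n n" "y \<in> carrier_mat n n" "z \<in> carrier_mat n n"
          and "double_bracket c3 c1 x y z = T"
          by (rule double_bracket_trace_zero[OF T tr field \<open>c3 \<noteq> 0\<close>])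
        then have "g y x z = T" using g double_bracket_swap[OF xyz, of c3 c1] by simp
        with xyz show ?thesis by blast
      qed
    qed
  qed
  with that show thesis unfolding g_def by blast
qed

theorem theorem13:
  fixes n m :: nat and f :: "'k::field nc_poly"
  assumes "n \<ge> 2"
    and "infinite (UNIV :: 'k set) \<or> card (UNIV :: 'k set) \<ge> n"
    and "m \<in> {1, 2, 3}"
    and "f \<in> nc_polys m"
    and "multilinear m f"
    and "f \<noteq> 0"
  shows "{M \<in> carrier_mat n n. mat_trace M = 0} \<subseteq> nc_values (module_mat TYPE('k) n n) m f"
proof
  fix M :: "'k mat"
  assume "M \<in> {M \<in> carrier_mat n n. mat_trace M = 0}"
  then have M: "M \<in> carrier_mat n n" and tr: "mat_trace M = 0" by auto
  note field = assms(2)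
  consider "m = 1" | "m = 2" | "m = 3" using assms(3) by blast
  then show "M \<in> nc_values (module_mat TYPE('k) n n) m f"
  proof cases
    case 1
    obtain c where c: "c \<noteq> 0"
      and v: "\<And>x. x \<in> carrier_mat n n \<Longrightarrow> c \<cdot>\<^sub>m x \<in> nc_values (module_mat TYPE('k) n n) 1 f"
      using nc_values_1[of f n] assms(5,6) 1 by blast
    have "c \<cdot>\<^sub>m (inverse c \<cdot>\<^sub>m M) = M" using M c by (intro eq_matI) auto
    with v[of "inverse c \<cdot>\<^sub>m M"] M 1 show ?thesis by simp
  next
    case 2
    with assms(5,6) obtain a b where ab: "a \<noteq> 0 \<or> b \<noteq> 0"
      and v: "\<And>x y. x \<in> carrier_mat n n \<Longrightarrow> y \<in> carrier_mat n n \<Longrightarrow>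
        a \<cdot>\<^sub>m (x * y) + b \<cdot>\<^sub>m (y * x) \<in> nc_values (module_mat TYPE('k) n n) 2 f"
      using nc_values_2[of f n] by blast
    obtain x y where "x \<in> carrier_mat n n" "y \<in> carrier_mat n n"
      "a \<cdot>\<^sub>m (x * y) + b \<cdot>\<^sub>m (y * x) = M"
      by (rule degree_two_value[OF M tr field ab])
    with v 2 show ?thesis by blast
  next
    case 3
    with assms(5) have "multilinear 3 f" by simp
    then obtain c1 c2 c3 c4 c5 c6
      where nz: "\<not> (c1 = 0 \<and> c2 = 0 \<and> c3 = 0 \<and> c4 = 0 \<and> c5 = 0 \<and> c6 = 0)"
        and v: "\<And>x y z. x \<in> carrier_mat n n \<Longrightarrow> y \<in> carrier_mat n n \<Longrightarrow> z \<in> carrier_mat n n \<Longrightarrow>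
          c1 \<cdot>\<^sub>m (x * (y * z)) + (c2 \<cdot>\<^sub>m (x * (z * y)) + (c3 \<cdot>\<^sub>m (y * (x * z)) +
          (c4 \<cdot>\<^sub>m (y * (z * x)) + (c5 \<cdot>\<^sub>m (z * (x * y)) + c6 \<cdot>\<^sub>m (z * (y * x))))))
          \<in> nc_values (module_mat TYPE('k) n n) 3 f"
      by (rule nc_values_3[OF _ assms(6)]) blast
    show ?thesis
      by (rule degree_three_value[OF M tr field nz]) (use v 3 in blast)
  qed
qed

end
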